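(* Let $k$ be a field and $A\in\operatorname{Mat}_{n\times n}(k)$ with index $i(A)=r\ge 1$. For $i\in\{1,\dots,r\}$ put $\nu_i(A)=n-\operatorname{rk}(A^i)$. Let $A\{GD\}$ be the set of G-Drazin inverses of $A$. Then there exists a bijection $$k^{\nu_1(A)\cdot\nu_r(A)}\times k^{\nu_r(A)-\nu_1(A)}\times k^{[\nu_1(A)-1][\nu_r(A)-\nu_1(A)]}\;\longrightarrow\;A\{GD\}.$$
   Context: The index $i(A)$ of a square matrix $A$ is the smallest integer $r\ge 0$ such that $\operatorname{rk}(A^{r})=\operatorname{rk}(A^{r+1})$. A matrix $X\in\operatorname{Mat}_{n\times n}(k)$ is a G-Drazin inverse of $A$ (with $r=i(A)$) if $AXA=A$ and $XA^{r}=A^{r}X$. *)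

theory Defs
  imports "HOL-Analysis.Analysis"
begin

text \<open>Powers of square matrices: A^0 = I, A^(m+1) = A * A^m.\<close>
primrec matpow :: "'a::field^'n^'n \<Rightarrow> nat \<Rightarrow> 'a^'n^'n" where
  "matpow A 0 = mat 1"
| "matpow A (Suc m) = A ** matpow A m"

text \<open>Index i(A): the least r \<ge> 0 with rk(A^r) = rk(A^(r+1)).\<close>
definition mat_index :: "'a::field^'n^'n \<Rightarrow> nat" where
  "mat_index A = (LEAST r. rank (matpow A r) = rank (matpow A (Suc r)))"

text \<open>nu_i(A) = n - rk(A^i), with n = CARD('n).\<close>
definition nu :: "nat \<Rightarrow> 'a::field^'n^'n \<Rightarrow> nat" where
  "nu i A = CARD('n) - rank (matpow A i)"

text \<open>The set A{GD} of G-Drazin inverses of A.\<close>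
definition GD_inverses :: "'a::field^'n^'n \<Rightarrow> ('a^'n^'n) set" where
  "GD_inverses A = {X. A ** X ** A = A \<and>
      X ** matpow A (mat_index A) = matpow A (mat_index A) ** X}"

text \<open>k^m, represented as lists of length m.\<close>
definition kpow :: "nat \<Rightarrow> 'a list set" where
  "kpow m = {xs. length xs = m}"

end

theory Submission
  imports Defs
begin

text \<open>
  Ranks are row ranks, so we work with the transpose B of A acting on column vectors; the
  G-Drazin conditions are invariant under transposition. With T = B^r, stability of the rank
  at r gives the Fitting decomposition R \<oplus> K of the whole space, R = range T, K = ker T,
  where B is bijective on R and N = ker B \<subseteq> K because r \<ge> 1. Two G-Drazin inverses differ
  by some Y with BYB = 0 and YT = TY, which forces YT = 0; so the G-Drazin inverses form a
  coset of H = {Y. BYB = 0, YT = 0, TY = 0}. A matrix lies in H iff it kills R, maps BK into N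
  and maps everything into K. In a basis adapted to R and BK \<subseteq> K on the domain side and to
  N \<subseteq> K on the target side, H becomes the space of matrices with a fixed zero pattern having
  dim N * dim BK + dim K * dim N free entries. As dim N = nu_1 \<ge> 1 (r is the least stable
  exponent), dim K = nu_r and dim BK = nu_r - nu_1, this is
  nu_1 nu_r + (nu_r - nu_1) + (nu_1 - 1)(nu_r - nu_1).
\<close>

section \<open>Matrix powers and rank--nullity\<close>

lemma matpow_Suc_right: "matpow A (Suc m) = matpow A m ** A"
  by (induction m) (simp_all add: matrix_mul_assoc)

lemma matpow_commute: "A ** matpow A m = matpow A m ** A"
  by (metis matpow.simps(2) matpow_Suc_right)

lemma transpose_matpow: "transpose (matpow A m) = matpow (transpose A) m"
  by (induction m) (simp_all add: matrix_transpose_mul matpow_commute)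

lemma column_eq_matrix_vector_mult_axis: "column i M = M *v axis i (1::'a::field)"
  by (simp add: column_def matrix_vector_mult_def axis_def vec_eq_iff if_distrib cong: if_cong)

lemma span_range_matrix_vector_mult:
  fixes M :: "'a::field^'n^'m"
  shows "vec.span (range ((*v) M)) = vec.span (columns M)"
  unfolding vec.span_eq
  using matrix_vector_mult_in_columnspace_gen
  by (auto simp: columns_def column_eq_matrix_vector_mult_axis intro: vec.span_base)

lemma rank_eq_dim_range_transpose:
  fixes M :: "'a::field^'n^'m"
  shows "rank M = vec.dim (range ((*v) (transpose M)))"
  by (metis columns_transpose row_rank_def_gen span_range_matrix_vector_mult vec.dim_span)

lemma subspace_range_matrix_vector_mult: "vec.subspace (range ((*v) (M::'a::field^'n^'m)))"
  using vec.subspace_image[OF vec.subspace_UNIV] by blast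

lemma ex_rank_matpow_eq_Suc:
  fixes A :: "'a::field^'n^'n"
  shows "\<exists>m. rank (matpow A m) = rank (matpow A (Suc m))"
proof (rule ccontr)
  assume "\<nexists>m. rank (matpow A m) = rank (matpow A (Suc m))"
  moreover have "rank (matpow A (Suc m)) \<le> rank (matpow A m)" for m
  proof -
    have "matpow (transpose A) (Suc m) *v x = matpow (transpose A) m *v (transpose A *v x)" for x
      by (simp only: matpow_Suc_right matrix_vector_mul_assoc)
    then have "range ((*v) (matpow (transpose A) (Suc m))) \<subseteq> range ((*v) (matpow (transpose A) m))"
      by auto
    then show ?thesis
      unfolding rank_eq_dim_range_transpose transpose_matpow by (rule vec.dim_subset)
  qed
  ultimately have decreasing: "rank (matpow A (Suc m)) < rank (matpow A m)" for m
    by (metis le_neq_implies_less)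
  have "rank (matpow A m) + m \<le> rank (matpow A 0)" for m
  proof (induction m)
    case (Suc m)
    then show ?case using decreasing[of m] by linarith
  qed simp
  from this[of "Suc (rank (matpow A 0))"] show False by simp
qed

lemma span_Int_span_eq_0:
  assumes "vec.independent (S \<union> T)" and "S \<inter> T = {}"
  shows "vec.span S \<inter> vec.span T = {0::'a::field^'n}"
proof -
  have fin: "finite (S \<union> T)" using assms(1) vec.finiteI_independent by blast
  have "vec.dim (vec.span (S \<union> T)) + vec.dim (vec.span S \<inter> vec.span T)
      = vec.dim (vec.span S) + vec.dim (vec.span T)"
    unfolding vec.span_Un by (rule vec.dim_sums_Int) auto
  moreover have "vec.dim (vec.span (S \<union> T)) = card S + card T"
    using assms fin by (simp add: vec.dim_eq_card_independent card_Un_disjoint)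
  moreover have "vec.independent S" "vec.independent T"
    using vec.independent_mono[OF assms(1)] by simp_all
  then have "vec.dim (vec.span S) = card S" "vec.dim (vec.span T) = card T"
    by (simp_all add: vec.dim_span vec.dim_eq_card_independent)
  ultimately have "vec.span S \<inter> vec.span T \<subseteq> {0}"
    by (simp add: vec.dim_eq_0)
  then show ?thesis
    using vec.span_zero by auto
qed

lemma span_image_Diff_kernel:
  fixes M :: "'a::field^'n^'m"
  assumes "\<And>x. x \<in> Z \<Longrightarrow> M *v x = 0"
  shows "vec.span ((*v) M ` B) = vec.span ((*v) M ` (B - Z))"
proof (rule vec.span_eq[THEN iffD2], intro conjI subsetI)
  fix y assume "y \<in> (*v) M ` B"
  then obtain x where "x \<in> B" "y = M *v x" by blast
  show "y \<in> vec.span ((*v) M ` (B - Z))"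
  proof (cases "x \<in> Z")
    case True
    then show ?thesis using assms \<open>y = M *v x\<close> by (simp add: vec.span_zero)
  next
    case False
    then show ?thesis using \<open>x \<in> B\<close> \<open>y = M *v x\<close> by (auto intro: vec.span_base)
  qed
qed (auto intro: vec.span_base)

lemma rank_nullity_subspace:
  fixes M :: "'a::field^'n^'m"
  assumes S: "vec.subspace S"
  shows "vec.dim S = vec.dim ((*v) M ` S) + vec.dim {v\<in>S. M *v v = 0}"
proof -
  let ?Z = "{v\<in>S. M *v v = 0}"
  obtain B0 where B0: "B0 \<subseteq> ?Z" "vec.independent B0" "?Z \<subseteq> vec.span B0"
    using vec.maximal_independent_subset by blast
  then obtain B1 where B1: "B0 \<subseteq> B1" "B1 \<subseteq> S" "vec.independent B1" "S \<subseteq> vec.span B1"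
    using vec.maximal_independent_subset_extend[of B0 S] by blast
  define C where "C = B1 - B0"
  have indC: "vec.independent C"
    unfolding C_def using B1(3) by (rule vec.independent_mono) blast
  have inj: "inj_on ((*v) M) (vec.span C)"
    unfolding vec.inj_on_iff_eq_0[OF vec.subspace_span]
  proof (intro ballI impI)
    fix x assume x: "x \<in> vec.span C" "M *v x = 0"
    have "vec.span C \<subseteq> S"
      using B1(2) S C_def by (intro vec.span_minimal) auto
    then have "x \<in> S" using x(1) by blast
    then have "x \<in> vec.span B0" using x(2) B0(3) by blast
    moreover have "vec.span B0 \<inter> vec.span C = {0}"
      using B1 C_def by (intro span_Int_span_eq_0) (auto simp: Un_absorb1)
    ultimately show "x = 0" using x(1) by blast
  qed
  have "(*v) M ` S = vec.span ((*v) M ` B1)"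
    using vec.span_subspace[OF B1(2,4) S]
    by (simp add: vec.linear_span_image[OF matrix_vector_mul_linear_gen])
  also have "\<dots> = vec.span ((*v) M ` C)"
    unfolding C_def using B0(1) by (intro span_image_Diff_kernel) blast
  finally have "vec.dim ((*v) M ` S) = card C"
    using vec.dim_image_eq[OF matrix_vector_mul_linear_gen inj] indC
    by (simp add: vec.dim_span vec.dim_eq_card_independent)
  moreover have "vec.dim ?Z = card B0"
    using vec.basis_card_eq_dim[OF B0(1,3,2)] by simp
  moreover have "vec.dim S = card B1"
    using vec.basis_card_eq_dim[OF B1(2,4,3)] by simp
  ultimately show ?thesis
    using B1(1) vec.finiteI_independent[OF B1(3)] C_def
    by (simp add: card_Diff_subset card_mono finite_subset)
qed

section \<open>Indexed bases and change of basis\<close>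

lemma invertible_imp_matrix_inv:
  fixes A :: "'a::field^'n^'n"
  assumes "invertible A"
  shows "A ** matrix_inv A = mat 1" and "matrix_inv A ** A = mat 1"
  using someI_ex[OF assms[unfolded invertible_def]] by (simp_all add: matrix_inv_def)

lemma matrix_entry_eq_axis: "M $ i $ j = (M *v axis j (1::'a::field)) $ i"
  by (simp add: column_def flip: column_eq_matrix_vector_mult_axis)

definition indexed_basis :: "('n \<Rightarrow> 'a::field^'n) \<Rightarrow> bool" where
  "indexed_basis q \<longleftrightarrow> inj q \<and> vec.independent (range q)"

definition column_matrix :: "('n \<Rightarrow> 'a::field^'m) \<Rightarrow> 'a^'n^'m" where
  "column_matrix q = transpose (\<chi> j. q j)"

lemma column_column_matrix: "column j (column_matrix q) = q j"
  by (simp add: column_matrix_def row_def)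

lemma column_matrix_axis: "column_matrix q *v axis j 1 = q j"
  by (metis column_column_matrix column_eq_matrix_vector_mult_axis)

lemma span_indexed_basis:
  fixes q :: "'n \<Rightarrow> 'a::field^'n"
  assumes "indexed_basis q"
  shows "vec.span (range q) = UNIV"
proof -
  have "card (range q) = vec.dim (UNIV :: ('a^'n) set)"
    using assms by (simp add: indexed_basis_def card_image vec_dim_card card_cart_basis)
  then show ?thesis
    using assms vec.card_eq_dim[of "range q" UNIV] by (auto simp: indexed_basis_def)
qed

lemma invertible_column_matrix:
  assumes "indexed_basis q"
  shows "invertible (column_matrix q)"
proof -
  have "rows (\<chi> j. q j) = range q"
    by (auto simp: rows_def row_def vec_lambda_eta)
  then show ?thesis
    unfolding column_matrix_def invertible_right_inverse right_invertible_transpose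
      matrix_left_invertible_span_rows_gen
    using span_indexed_basis[OF assms] by simp
qed

lemma matrix_inv_column_matrix_basis:
  assumes "indexed_basis q"
  shows "matrix_inv (column_matrix q) *v q i = axis i 1"
  by (metis column_matrix_axis invertible_column_matrix[OF assms] invertible_imp_matrix_inv(2)
      matrix_vector_mul_assoc matrix_vector_mul_lid)

lemma in_span_image_basis_iff:
  fixes q :: "'n \<Rightarrow> 'a::field^'n"
  assumes q: "indexed_basis q"
  shows "w \<in> vec.span (q ` I)
    \<longleftrightarrow> (\<forall>i. i \<notin> I \<longrightarrow> (matrix_inv (column_matrix q) *v w) $ i = 0)"
proof
  let ?V = "{w. matrix_inv (column_matrix q) *v w \<in> {x. \<forall>i. i \<notin> I \<longrightarrow> x $ i = 0}}"
  have "vec.subspace {x::'a^'n. \<forall>i. i \<notin> I \<longrightarrow> x $ i = 0}"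
    by (simp add: vec.subspace_def)
  then have "vec.subspace ?V"
    by (rule vec.subspace_linear_preimage)
  moreover have "q ` I \<subseteq> ?V"
    using matrix_inv_column_matrix_basis[OF q] by (auto simp: axis_def)
  ultimately have "vec.span (q ` I) \<subseteq> ?V"
    by (rule vec.span_minimal[rotated])
  then show "w \<in> vec.span (q ` I)
      \<Longrightarrow> \<forall>i. i \<notin> I \<longrightarrow> (matrix_inv (column_matrix q) *v w) $ i = 0"
    by blast
next
  let ?c = "matrix_inv (column_matrix q) *v w"
  assume outside: "\<forall>i. i \<notin> I \<longrightarrow> ?c $ i = 0"
  have "w = column_matrix q *v ?c"
    using invertible_imp_matrix_inv(1)[OF invertible_column_matrix[OF q]]
    by (simp add: matrix_vector_mul_assoc)
  also have "\<dots> = (\<Sum>i\<in>UNIV. ?c $ i *s q i)"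
    by (simp only: matrix_mult_sum column_column_matrix)
  also have "\<dots> = (\<Sum>i\<in>I. ?c $ i *s q i)"
    using outside by (intro sum.mono_neutral_right) auto
  also have "\<dots> \<in> vec.span (q ` I)"
    by (intro vec.span_sum vec.span_scale vec.span_base) auto
  finally show "w \<in> vec.span (q ` I)" .
qed

lemma ex_matrix_basis_values:
  assumes "indexed_basis p"
  shows "\<exists>X. \<forall>j. X *v p j = s j"
proof (intro exI allI)
  fix j
  show "(column_matrix s ** matrix_inv (column_matrix p)) *v p j = s j"
    by (simp add: matrix_inv_column_matrix_basis[OF assms] column_matrix_axis
        flip: matrix_vector_mul_assoc)
qed

lemma bij_betw_change_of_basis:
  assumes p: "indexed_basis p" and q: "indexed_basis q"
  shows "bij_betw (\<lambda>M. column_matrix q ** M ** matrix_inv (column_matrix p))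
     {M. \<forall>i j. i \<notin> I j \<longrightarrow> M $ i $ j = 0} {Y. \<forall>j. Y *v p j \<in> vec.span (q ` I j)}"
proof -
  let ?P = "column_matrix p" and ?Q = "column_matrix q"
  note P = invertible_imp_matrix_inv[OF invertible_column_matrix[OF p]]
  note Q = invertible_imp_matrix_inv[OF invertible_column_matrix[OF q]]
  have coordinates: "(matrix_inv ?Q ** Y ** ?P) $ i $ j = (matrix_inv ?Q *v (Y *v p j)) $ i" for Y i j
    by (subst matrix_entry_eq_axis) (simp add: column_matrix_axis flip: matrix_vector_mul_assoc)
  have left: "matrix_inv ?Q ** (?Q ** M ** matrix_inv ?P) ** ?P = M" for M
  proof -
    have "matrix_inv ?Q ** (?Q ** M ** matrix_inv ?P) ** ?P
        = (matrix_inv ?Q ** ?Q) ** M ** (matrix_inv ?P ** ?P)"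
      by (simp add: matrix_mul_assoc)
    then show ?thesis using P Q by simp
  qed
  have right: "?Q ** (matrix_inv ?Q ** Y ** ?P) ** matrix_inv ?P = Y" for Y
  proof -
    have "?Q ** (matrix_inv ?Q ** Y ** ?P) ** matrix_inv ?P
        = (?Q ** matrix_inv ?Q) ** Y ** (?P ** matrix_inv ?P)"
      by (simp add: matrix_mul_assoc)
    then show ?thesis using P Q by simp
  qed
  show ?thesis
  proof (rule bij_betw_byWitness[where f' = "\<lambda>Y. matrix_inv ?Q ** Y ** ?P"])
    show "(\<lambda>M. ?Q ** M ** matrix_inv ?P) ` {M. \<forall>i j. i \<notin> I j \<longrightarrow> M $ i $ j = 0}
        \<subseteq> {Y. \<forall>j. Y *v p j \<in> vec.span (q ` I j)}"
      using coordinates[of "?Q ** _ ** matrix_inv ?P"] by (auto simp: in_span_image_basis_iff[OF q] left)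
    show "(\<lambda>Y. matrix_inv ?Q ** Y ** ?P) ` {Y. \<forall>j. Y *v p j \<in> vec.span (q ` I j)}
        \<subseteq> {M. \<forall>i j. i \<notin> I j \<longrightarrow> M $ i $ j = 0}"
      using coordinates by (auto simp: in_span_image_basis_iff[OF q])
  qed (simp_all add: left right)
qed

definition adapted_to :: "('n \<Rightarrow> 'a::field^'n) \<Rightarrow> ('a^'n) set \<Rightarrow> bool" where
  "adapted_to q U \<longleftrightarrow> U \<subseteq> vec.span (range q \<inter> U)"

lemma span_adapted:
  assumes "vec.subspace U" and "adapted_to q U"
  shows "vec.span (q ` {i. q i \<in> U}) = U"
proof -
  have "q ` {i. q i \<in> U} = range q \<inter> U" by auto
  then show ?thesis
    using assms vec.span_subspace[of "range q \<inter> U" U] by (simp add: adapted_to_def)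
qed

lemma card_adapted:
  assumes q: "indexed_basis q" and "adapted_to q U"
  shows "card {i. q i \<in> U} = vec.dim U"
proof -
  have "inj_on q {i. q i \<in> U}"
    using q inj_on_subset[of q UNIV] by (simp add: indexed_basis_def)
  then have "card {i. q i \<in> U} = card (q ` {i. q i \<in> U})"
    by (simp add: card_image)
  also have "q ` {i. q i \<in> U} = range q \<inter> U"
    by auto
  also have "card (range q \<inter> U) = vec.dim U"
  proof (rule vec.basis_card_eq_dim)
    show "U \<subseteq> vec.span (range q \<inter> U)"
      using \<open>adapted_to q U\<close> by (simp add: adapted_to_def)
    show "vec.independent (range q \<inter> U)"
      using q vec.independent_mono[of "range q" "range q \<inter> U"] by (simp add: indexed_basis_def)
  qed simp
  finally show ?thesis .
qed

lemma adapted_subset: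
  assumes "adapted_to q U" and "vec.subspace V" and "\<And>i. q i \<in> U \<Longrightarrow> q i \<in> V"
  shows "U \<subseteq> V"
  using assms vec.span_minimal[of "range q \<inter> U" V] by (auto simp: adapted_to_def)

lemma ex_indexed_basis_extending:
  assumes "vec.independent S"
  shows "\<exists>q :: 'n \<Rightarrow> 'a::field^'n. indexed_basis q \<and> S \<subseteq> range q"
proof -
  obtain B where B: "S \<subseteq> B" "vec.independent B" "UNIV \<subseteq> vec.span B"
    by (rule vec.maximal_independent_subset_extend[OF subset_UNIV assms])
  have "card B = CARD('n)"
    using vec.basis_card_eq_dim[OF subset_UNIV B(3,2)] by (simp add: vec_dim_card card_cart_basis)
  then have "\<exists>q. bij_betw q (UNIV :: 'n set) B"
    by (intro finite_same_card_bij) (simp_all add: vec.finiteI_independent[OF B(2)])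
  then obtain q :: "'n \<Rightarrow> 'a^'n" where q: "bij_betw q UNIV B" ..
  have "indexed_basis q"
    using B(2) bij_betw_imp_inj_on[OF q] bij_betw_imp_surj_on[OF q] by (simp add: indexed_basis_def)
  with B(1) bij_betw_imp_surj_on[OF q] show ?thesis by blast
qed

lemma independent_Un_bases:
  fixes V W :: "('a::field^'n) set"
  assumes subspaces: "vec.subspace V" "vec.subspace W" and "V \<inter> W \<subseteq> {0}"
    and BV: "BV \<subseteq> V" "vec.independent BV" "V \<subseteq> vec.span BV"
    and BW: "BW \<subseteq> W" "vec.independent BW" "W \<subseteq> vec.span BW"
  shows "vec.independent (BV \<union> BW)"
proof (rule vec.card_le_dim_spanning)
  let ?VW = "{x + y |x y. x \<in> V \<and> y \<in> W}"
  have "x + 0 \<in> ?VW" if "x \<in> V" for x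
    using that vec.subspace_0[OF subspaces(2)] by blast
  moreover have "0 + y \<in> ?VW" if "y \<in> W" for y
    using that vec.subspace_0[OF subspaces(1)] by blast
  ultimately show "BV \<union> BW \<subseteq> ?VW"
    using BV(1) BW(1) by auto
  show "?VW \<subseteq> vec.span (BV \<union> BW)"
    using BV(3) BW(3) vec.span_mono[of BV "BV \<union> BW"] vec.span_mono[of BW "BV \<union> BW"]
    by (blast intro: vec.span_add)
  show "finite (BV \<union> BW)"
    using vec.finiteI_independent[OF BV(2)] vec.finiteI_independent[OF BW(2)] by simp
  have "0 \<notin> BV"
    using BV(2) vec.dependent_zero by blast
  then have "BV \<inter> BW = {}"
    using BV(1) BW(1) \<open>V \<inter> W \<subseteq> {0}\<close> by blast
  then have "card (BV \<union> BW) = vec.dim V + vec.dim W"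
    using vec.finiteI_independent[OF BV(2)] vec.finiteI_independent[OF BW(2)]
      vec.basis_card_eq_dim[OF BV(1,3,2)] vec.basis_card_eq_dim[OF BW(1,3,2)]
    by (simp add: card_Un_disjoint)
  also have "\<dots> = vec.dim ?VW"
  proof -
    have "vec.dim (V \<inter> W) = 0"
      using \<open>V \<inter> W \<subseteq> {0}\<close> by (simp add: vec.dim_eq_0)
    then show ?thesis
      using vec.dim_sums_Int[OF subspaces] by linarith
  qed
  finally show "card (BV \<union> BW) \<le> vec.dim ?VW" by simp
qed

lemma ex_indexed_basis_adapted:
  fixes U V W :: "('a::field^'n) set"
  assumes subspaces: "vec.subspace U" "vec.subspace V" "vec.subspace W"
    and "U \<subseteq> V" and "V \<inter> W \<subseteq> {0}"
  shows "\<exists>q. indexed_basis q \<and> adapted_to q U \<and> adapted_to q V \<and> adapted_to q W"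
proof -
  obtain BU where BU: "BU \<subseteq> U" "vec.independent BU" "U \<subseteq> vec.span BU"
    by (rule vec.maximal_independent_subset)
  have "BU \<subseteq> V" using BU(1) \<open>U \<subseteq> V\<close> by blast
  then obtain BV where BV: "BU \<subseteq> BV" "BV \<subseteq> V" "vec.independent BV" "V \<subseteq> vec.span BV"
    by (rule vec.maximal_independent_subset_extend[OF _ BU(2)])
  obtain BW where BW: "BW \<subseteq> W" "vec.independent BW" "W \<subseteq> vec.span BW"
    by (rule vec.maximal_independent_subset)
  have "vec.independent (BV \<union> BW)"
    using subspaces(2,3) \<open>V \<inter> W \<subseteq> {0}\<close> BV(2-4) BW by (rule independent_Un_bases)
  then obtain q :: "'n \<Rightarrow> 'a^'n" where q: "indexed_basis q" "BV \<union> BW \<subseteq> range q"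
    using ex_indexed_basis_extending by blast
  have adapted: "adapted_to q X" if "B \<subseteq> X" "X \<subseteq> vec.span B" "B \<subseteq> range q" for X B
    using that vec.span_mono[of B "range q \<inter> X"] by (auto simp: adapted_to_def)
  have "adapted_to q U"
    using BU(1,3) BV(1) q(2) by (intro adapted[of BU]) auto
  moreover have "adapted_to q V"
    using BV(2,4) q(2) by (intro adapted[of BV]) auto
  moreover have "adapted_to q W"
    using BW(1,3) q(2) by (intro adapted[of BW]) auto
  ultimately show ?thesis
    using q(1) by blast
qed

section \<open>Lists as coordinates\<close>

lemma bij_betw_append3:
  "bij_betw (\<lambda>(x, y, z). x @ y @ z) (kpow a \<times> kpow b \<times> kpow c) (kpow (a + b + c))"
proof (rule bij_betw_byWitness[where f' = "\<lambda>l. (take a l, take b (drop a l), drop (a + b) l)"])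
  show "\<forall>l\<in>kpow (a + b + c).
      (\<lambda>(x, y, z). x @ y @ z) (take a l, take b (drop a l), drop (a + b) l) = l"
    by (auto simp: kpow_def) (metis append_take_drop_id drop_drop add.commute)
qed (auto simp: kpow_def)

lemma bij_betw_lists_supported_matrices:
  fixes S :: "('m::finite \<times> 'n::finite) set"
  shows "\<exists>f. bij_betw f (kpow (card S) :: 'a list set)
    {M :: 'a::zero^'n^'m. \<forall>i j. (i, j) \<notin> S \<longrightarrow> M $ i $ j = 0}"
proof -
  obtain g where g: "bij_betw g {0..<card S} S"
    using ex_bij_betw_nat_finite[of S] by auto
  define g' where "g' = inv_into {0..<card S} g"
  have g'g: "g' (g k) = k" if "k < card S" for k
    using g that by (simp add: g'_def bij_betw_def inv_into_f_f)
  have gg': "g (g' x) = x" and g'_less: "g' x < card S" if "x \<in> S" for x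
    using g that bij_betw_inv_into[OF g] by (auto simp: g'_def bij_betw_def f_inv_into_f)
  have gS: "g k \<in> S" if "k < card S" for k
    using g that by (auto simp: bij_betw_def)
  define f :: "'a list \<Rightarrow> 'a^'n^'m" where
    "f xs = (\<chi> i j. if (i, j) \<in> S then xs ! g' (i, j) else 0)" for xs
  define f' :: "'a^'n^'m \<Rightarrow> 'a list" where
    "f' M = map (\<lambda>k. M $ fst (g k) $ snd (g k)) [0..<card S]" for M
  have "bij_betw f (kpow (card S)) {M. \<forall>i j. (i, j) \<notin> S \<longrightarrow> M $ i $ j = 0}"
  proof (rule bij_betw_byWitness[where f' = f'])
    show "\<forall>xs\<in>kpow (card S). f' (f xs) = xs"
      by (auto simp: kpow_def f_def f'_def gS g'g intro!: nth_equalityI)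
    show "\<forall>M\<in>{M. \<forall>i j. (i, j) \<notin> S \<longrightarrow> M $ i $ j = 0}. f (f' M) = M"
      by (auto simp: vec_eq_iff f_def f'_def g'_less gg')
  qed (auto simp: kpow_def f_def f'_def)
  then show ?thesis by blast
qed

section \<open>The Fitting decomposition and G-Drazin inverses\<close>

lemma dim_range_add_dim_kernel:
  fixes M :: "'a::field^'n^'m"
  shows "vec.dim (range ((*v) M)) + vec.dim {v. M *v v = 0} = CARD('n)"
  using rank_nullity_subspace[OF vec.subspace_UNIV, of M]
  by (simp add: vec_dim_card card_cart_basis)

locale fitting =
  fixes B :: "'a::field^'n^'n" and r :: nat
  assumes index_pos: "1 \<le> r"
    and dim_range_stable:
      "vec.dim (range ((*v) (matpow B (Suc r)))) = vec.dim (range ((*v) (matpow B r)))"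
begin

abbreviation T where "T \<equiv> matpow B r"

definition R where "R = range ((*v) T)"
definition K where "K = {v. T *v v = 0}"
definition N where "N = {v. B *v v = 0}"

lemma subspace_R: "vec.subspace R"
  unfolding R_def by (rule subspace_range_matrix_vector_mult)

lemma subspace_K: "vec.subspace K"
  unfolding K_def by (rule vec.subspace_kernel)

lemma subspace_N: "vec.subspace N"
  unfolding N_def by (rule vec.subspace_kernel)

lemma subspace_image_K: "vec.subspace ((*v) B ` K)"
  by (rule vec.subspace_image[OF subspace_K])

lemma image_R: "(*v) B ` R = R"
proof -
  have "(*v) B ` R = range ((*v) (matpow B (Suc r)))"
    by (simp add: R_def image_image matrix_vector_mul_assoc)
  also have "\<dots> = R"
  proof (rule vec.subspace_dim_equal[OF subspace_range_matrix_vector_mult subspace_R])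
    have "matpow B (Suc r) *v v = T *v (B *v v)" for v
      by (simp only: matpow_Suc_right matrix_vector_mul_assoc)
    then show "range ((*v) (matpow B (Suc r))) \<subseteq> R"
      by (auto simp: R_def)
    show "vec.dim R \<le> vec.dim (range ((*v) (matpow B (Suc r))))"
      using dim_range_stable by (simp only: R_def)
  qed
  finally show ?thesis .
qed

lemma image_matpow_R: "(*v) (matpow B m) ` R = R"
proof (induction m)
  case (Suc m)
  have "(*v) (matpow B (Suc m)) ` R = (*v) B ` ((*v) (matpow B m) ` R)"
    by (simp add: image_image matrix_vector_mul_assoc)
  then show ?case using Suc image_R by simp
qed simp

lemma R_Int_K: "R \<inter> K \<subseteq> {0}"
proof -
  have "vec.dim R = vec.dim ((*v) T ` R) + vec.dim {v\<in>R. T *v v = 0}"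
    by (rule rank_nullity_subspace[OF subspace_R])
  then have "vec.dim {v\<in>R. T *v v = 0} = 0"
    using image_matpow_R by simp
  then have "{v\<in>R. T *v v = 0} \<subseteq> {0}"
    by (simp only: vec.dim_eq_0)
  then show ?thesis
    by (auto simp: K_def)
qed

lemma dim_R_add_dim_K: "vec.dim R + vec.dim K = CARD('n)"
  unfolding R_def K_def by (rule dim_range_add_dim_kernel)

lemma R_add_K: "\<exists>a k. a \<in> R \<and> k \<in> K \<and> v = a + k"
proof -
  let ?RK = "{a + k |a k. a \<in> R \<and> k \<in> K}"
  have "vec.dim (R \<inter> K) = 0"
    using R_Int_K by (simp add: vec.dim_eq_0)
  then have "vec.dim ?RK = CARD('n)"
    using vec.dim_sums_Int[OF subspace_R subspace_K] dim_R_add_dim_K by linarith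
  then have "vec.dim ?RK = vec.dim (UNIV :: ('a^'n) set)"
    by (simp only: vec_dim_card)
  then have "?RK = UNIV"
    by (intro vec.subspace_dim_equal[OF vec.subspace_sums[OF subspace_R subspace_K]]) simp_all
  then show ?thesis by blast
qed

lemma image_K_subset: "(*v) B ` K \<subseteq> K"
proof clarify
  fix v assume "v \<in> K"
  have "T *v (B *v v) = B *v (T *v v)"
    by (simp only: matrix_vector_mul_assoc matpow_commute)
  then show "B *v v \<in> K"
    using \<open>v \<in> K\<close> by (simp add: K_def)
qed

lemma N_subset_K: "N \<subseteq> K"
proof
  fix v assume "v \<in> N"
  obtain s where "r = Suc s" using index_pos by (cases r) auto
  then have "T *v v = matpow B s *v (B *v v)"
    by (simp only: matpow_Suc_right matrix_vector_mul_assoc)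
  then show "v \<in> K" using \<open>v \<in> N\<close> by (simp add: K_def N_def)
qed

lemma dim_image_K_add_dim_N: "vec.dim ((*v) B ` K) + vec.dim N = vec.dim K"
proof -
  have "{v\<in>K. B *v v = 0} = N"
    using N_subset_K by (auto simp: N_def)
  then show ?thesis
    using rank_nullity_subspace[OF subspace_K, of B] by simp
qed

lemma inj_on_R: "inj_on ((*v) B) R"
proof (unfold vec.inj_on_iff_eq_0[OF subspace_R], intro ballI impI)
  fix v assume "v \<in> R" "B *v v = 0"
  then have "v \<in> R \<inter> K"
    using N_subset_K by (auto simp: N_def)
  then show "v = 0"
    using R_Int_K by blast
qed

definition GD where "GD = {X. B ** X ** B = B \<and> X ** T = T ** X}"

definition GD_homogeneous where
  "GD_homogeneous = {Y. B ** Y ** B = 0 \<and> Y ** T = 0 \<and> T ** Y = 0}"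

text \<open>Y maps R = B R into N \<subseteq> K, so YT = TY vanishes on R; since T maps R onto its whole
  range, YT vanishes everywhere.\<close>

lemma commuting_imp_annihilates_range:
  assumes BYB: "B ** Y ** B = 0" and comm: "Y ** T = T ** Y"
  shows "Y ** T = 0"
proof -
  have "(Y ** T) *v w = 0" for w
  proof -
    have "T *v w \<in> (*v) T ` R"
      using image_matpow_R[of r] by (simp add: R_def)
    then obtain v where v: "v \<in> R" "T *v w = T *v v"
      by blast
    obtain u where u: "u \<in> R" "v = B *v u"
      using image_R v(1) by blast
    have "B *v (Y *v (B *v u)) = (B ** Y ** B) *v u"
      by (simp add: matrix_vector_mul_assoc matrix_mul_assoc)
    then have "Y *v (B *v u) \<in> K"
      using BYB N_subset_K by (auto simp: N_def)
    moreover have "(Y ** T) *v w = T *v (Y *v (B *v u))"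
      using v u comm by (metis matrix_vector_mul_assoc)
    ultimately show ?thesis
      by (simp add: K_def)
  qed
  then show ?thesis
    by (simp add: matrix_eq)
qed

lemma GD_iff_diff_GD_homogeneous:
  assumes "X0 \<in> GD"
  shows "X \<in> GD \<longleftrightarrow> X - X0 \<in> GD_homogeneous"
proof -
  have diff: "B ** (X - X0) ** B = B ** X ** B - B ** X0 ** B"
    "(X - X0) ** T = X ** T - X0 ** T" "T ** (X - X0) = T ** X - T ** X0"
    by (simp_all add: matrix_matrix_mult_def vec_eq_iff sum_subtractf ring_distribs)
  show ?thesis
  proof
    assume "X \<in> GD"
    then have "B ** (X - X0) ** B = 0" "(X - X0) ** T = T ** (X - X0)"
      using assms diff by (simp_all add: GD_def)
    then show "X - X0 \<in> GD_homogeneous"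
      using commuting_imp_annihilates_range by (simp add: GD_homogeneous_def)
  next
    assume "X - X0 \<in> GD_homogeneous"
    then show "X \<in> GD"
      using assms diff by (simp add: GD_def GD_homogeneous_def)
  qed
qed

lemma GD_homogeneous_iff:
  "Y \<in> GD_homogeneous \<longleftrightarrow>
     (\<forall>v\<in>R. Y *v v = 0) \<and> (\<forall>v\<in>(*v) B ` K. Y *v v \<in> N) \<and> (\<forall>v. Y *v v \<in> K)"
proof
  assume "Y \<in> GD_homogeneous"
  then have Y: "B ** Y ** B = 0" "Y ** T = 0" "T ** Y = 0"
    by (simp_all add: GD_homogeneous_def)
  show "(\<forall>v\<in>R. Y *v v = 0) \<and> (\<forall>v\<in>(*v) B ` K. Y *v v \<in> N) \<and> (\<forall>v. Y *v v \<in> K)"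
    using Y by (auto simp: R_def N_def K_def matrix_vector_mul_assoc)
next
  assume Y: "(\<forall>v\<in>R. Y *v v = 0) \<and> (\<forall>v\<in>(*v) B ` K. Y *v v \<in> N) \<and> (\<forall>v. Y *v v \<in> K)"
  have "(B ** Y ** B) *v v = 0" for v
  proof -
    obtain a k where "a \<in> R" "k \<in> K" "v = a + k"
      using R_add_K by blast
    moreover have "B *v a \<in> R"
      using \<open>a \<in> R\<close> image_R by blast
    ultimately show ?thesis
      using Y by (auto simp: N_def matrix_vector_right_distrib simp flip: matrix_vector_mul_assoc)
  qed
  moreover have "(Y ** T) *v v = 0" "(T ** Y) *v v = 0" for v
    using Y by (auto simp: R_def K_def simp flip: matrix_vector_mul_assoc)
  ultimately show "Y \<in> GD_homogeneous"
    by (simp add: GD_homogeneous_def matrix_eq)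
qed

lemma GD_intro:
  assumes right_inverse: "\<And>w. w \<in> R \<Longrightarrow> B *v (X *v w) = w"
      "\<And>w. w \<in> (*v) B ` K \<Longrightarrow> B *v (X *v w) = w"
    and preserves: "\<And>w. w \<in> R \<Longrightarrow> X *v w \<in> R" "\<And>w. w \<in> K \<Longrightarrow> X *v w \<in> K"
  shows "X \<in> GD"
proof -
  have inverts_R: "X *v (B *v w) = w" if "w \<in> R" for w
  proof (rule inj_onD[OF inj_on_R])
    have "B *v w \<in> R"
      using that image_R by blast
    then show "B *v (X *v (B *v w)) = B *v w" "X *v (B *v w) \<in> R"
      using right_inverse(1) preserves(1) by auto
  qed (rule that)
  have "(B ** X ** B) *v v = B *v v" for v
  proof -
    obtain a k where ak: "a \<in> R" "k \<in> K" "v = a + k"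
      using R_add_K by blast
    have "B *v a \<in> R" "B *v k \<in> (*v) B ` K"
      using ak(1,2) image_R by blast+
    then show ?thesis
      using ak(3) right_inverse by (simp add: matrix_vector_right_distrib flip: matrix_vector_mul_assoc)
  qed
  moreover have "(X ** T) *v v = (T ** X) *v v" for v
  proof -
    obtain a k where ak: "a \<in> R" "k \<in> K" "v = a + k"
      using R_add_K by blast
    obtain a' where a': "a' \<in> R" "a = B *v a'"
      using ak(1) image_R by blast
    have "T *v a' \<in> R"
      by (simp add: R_def)
    moreover have "T *v (B *v a') = B *v (T *v a')"
      by (simp only: matrix_vector_mul_assoc matpow_commute)
    ultimately have "X *v (T *v a) = T *v (X *v a)"
      using a' inverts_R by simp
    moreover have "T *v k = 0" "T *v (X *v k) = 0"
      using ak(2) preserves(2) by (auto simp: K_def)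
    ultimately show ?thesis
      using ak(3) by (simp add: matrix_vector_right_distrib flip: matrix_vector_mul_assoc)
  qed
  ultimately show ?thesis
    by (auto simp: GD_def matrix_eq)
qed

lemma bij_betw_transpose_GD:
  "bij_betw transpose GD
     {X. transpose B ** X ** transpose B = transpose B
       \<and> X ** matpow (transpose B) r = matpow (transpose B) r ** X}"
proof -
  have GD_iff: "Y \<in> GD \<longleftrightarrow> transpose B ** transpose Y ** transpose B = transpose B
      \<and> transpose Y ** matpow (transpose B) r = matpow (transpose B) r ** transpose Y" for Y
  proof -
    have "transpose (B ** Y ** B) = transpose B ** transpose Y ** transpose B"
      by (simp add: matrix_transpose_mul matrix_mul_assoc)
    then have "B ** Y ** B = B \<longleftrightarrow> transpose B ** transpose Y ** transpose B = transpose B"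
      by (simp only: transpose_iff[symmetric, of "B ** Y ** B" B])
    moreover have "transpose (Y ** T) = matpow (transpose B) r ** transpose Y"
      "transpose (T ** Y) = transpose Y ** matpow (transpose B) r"
      by (simp_all add: matrix_transpose_mul transpose_matpow)
    then have "Y ** T = T ** Y
        \<longleftrightarrow> transpose Y ** matpow (transpose B) r = matpow (transpose B) r ** transpose Y"
      by (simp only: transpose_iff[symmetric, of "Y ** T" "T ** Y"]
          eq_commute[of "transpose (Y ** T)"])
    ultimately show ?thesis
      by (simp add: GD_def)
  qed
  show ?thesis
  proof (rule bij_betw_byWitness[where f' = transpose])
    show "transpose ` GD \<subseteq> {X. transpose B ** X ** transpose B = transpose B
        \<and> X ** matpow (transpose B) r = matpow (transpose B) r ** X}"
      using GD_iff by blast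
    show "transpose ` {X. transpose B ** X ** transpose B = transpose B
        \<and> X ** matpow (transpose B) r = matpow (transpose B) r ** X} \<subseteq> GD"
      using GD_iff[of "transpose _"] by auto
  qed simp_all
qed

end

section \<open>Counting G-Drazin inverses in adapted bases\<close>

locale fitting_bases = fitting B r for B :: "'a::field^'n^'n" and r +
  fixes p q :: "'n \<Rightarrow> 'a^'n"
  assumes p_basis: "indexed_basis p"
    and p_adapted: "adapted_to p R" "adapted_to p K" "adapted_to p ((*v) B ` K)"
    and q_basis: "indexed_basis q"
    and q_adapted: "adapted_to q N" "adapted_to q K"
begin

lemma p_nonzero: "p j \<noteq> 0"
  using p_basis vec.dependent_zero[of "range p"] by (auto simp: indexed_basis_def)

lemma p_in_R_imp_notin_K: "p j \<in> R \<Longrightarrow> p j \<notin> K"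
  using R_Int_K p_nonzero by blast

lemma p_in_R_or_K: "p j \<in> R \<or> p j \<in> K"
proof -
  have disjoint: "{j. p j \<in> R} \<inter> {j. p j \<in> K} = {}"
    using p_in_R_imp_notin_K by blast
  have "card ({j. p j \<in> R} \<union> {j. p j \<in> K}) = card (UNIV :: 'n set)"
    using card_Un_disjoint[OF _ _ disjoint] dim_R_add_dim_K
      card_adapted[OF p_basis p_adapted(1)] card_adapted[OF p_basis p_adapted(2)] by simp
  then have "{j. p j \<in> R} \<union> {j. p j \<in> K} = UNIV"
    by (intro card_subset_eq) simp_all
  then show ?thesis by blast
qed

lemma ex_basis_preimages:
  "\<exists>s. \<forall>j. (p j \<in> R \<longrightarrow> s j \<in> R \<and> B *v s j = p j)
      \<and> (p j \<notin> R \<longrightarrow> s j \<in> K \<and> (p j \<in> (*v) B ` K \<longrightarrow> B *v s j = p j))"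
proof (intro choice allI)
  fix j
  consider (R) "p j \<in> (*v) B ` R" | (image_K) "p j \<notin> R" "p j \<in> (*v) B ` K"
    | (other) "p j \<notin> R" "p j \<notin> (*v) B ` K"
    using image_R by blast
  then show "\<exists>u. (p j \<in> R \<longrightarrow> u \<in> R \<and> B *v u = p j)
      \<and> (p j \<notin> R \<longrightarrow> u \<in> K \<and> (p j \<in> (*v) B ` K \<longrightarrow> B *v u = p j))"
  proof cases
    case R
    then obtain u where "u \<in> R" "p j = B *v u" by blast
    then show ?thesis using image_R by (intro exI[of _ u]) auto
  next
    case image_K
    then obtain u where "u \<in> K" "p j = B *v u" by blast
    then show ?thesis using image_K by (intro exI[of _ u]) auto
  next
    case other
    then show ?thesis using vec.subspace_0[OF subspace_K] by (intro exI[of _ 0]) auto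
  qed
qed

lemma ex_GD: "\<exists>X. X \<in> GD"
proof -
  obtain s where s: "\<And>j. (p j \<in> R \<longrightarrow> s j \<in> R \<and> B *v s j = p j)
      \<and> (p j \<notin> R \<longrightarrow> s j \<in> K \<and> (p j \<in> (*v) B ` K \<longrightarrow> B *v s j = p j))"
    using ex_basis_preimages by blast
  obtain X where X: "\<And>j. X *v p j = s j"
    using ex_matrix_basis_values[OF p_basis] by blast
  have kernel: "vec.subspace {w. (B ** X - mat 1) *v w = 0}"
    by (rule vec.subspace_kernel)
  have "R \<subseteq> {w. (B ** X - mat 1) *v w = 0}"
    using s by (intro adapted_subset[OF p_adapted(1) kernel])
      (simp add: X matrix_vector_mult_diff_rdistrib flip: matrix_vector_mul_assoc)
  moreover have "(*v) B ` K \<subseteq> {w. (B ** X - mat 1) *v w = 0}"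
  proof (intro adapted_subset[OF p_adapted(3) kernel])
    fix j assume "p j \<in> (*v) B ` K"
    moreover from this have "p j \<notin> R"
      using p_in_R_imp_notin_K image_K_subset by blast
    ultimately show "p j \<in> {w. (B ** X - mat 1) *v w = 0}"
      using s[of j] by (simp add: X matrix_vector_mult_diff_rdistrib flip: matrix_vector_mul_assoc)
  qed
  moreover have "R \<subseteq> {w. X *v w \<in> R}"
    using s by (intro adapted_subset[OF p_adapted(1) vec.subspace_linear_preimage[OF subspace_R]])
      (simp add: X)
  moreover have "K \<subseteq> {w. X *v w \<in> K}"
  proof (intro adapted_subset[OF p_adapted(2) vec.subspace_linear_preimage[OF subspace_K]])
    fix j assume "p j \<in> K"
    then show "p j \<in> {w. X *v w \<in> K}"
      using s[of j] p_in_R_imp_notin_K[of j] by (auto simp: X)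
  qed
  ultimately have "X \<in> GD"
    by (intro GD_intro) (auto simp: matrix_vector_mult_diff_rdistrib simp flip: matrix_vector_mul_assoc)
  then show ?thesis ..
qed

text \<open>Entry (i, j) of the coordinate matrix of Y, with columns in the basis p and rows in the
  basis q, may be nonzero only for i \<in> basis_support j.\<close>

definition basis_support :: "'n \<Rightarrow> 'n set" where
  "basis_support j =
     (if p j \<in> R then {} else if p j \<in> (*v) B ` K then {i. q i \<in> N} else {i. q i \<in> K})"

lemma span_basis_support:
  "vec.span (q ` basis_support j) =
     (if p j \<in> R then {0} else if p j \<in> (*v) B ` K then N else K)"
  using span_adapted[OF subspace_N q_adapted(1)] span_adapted[OF subspace_K q_adapted(2)]
  by (simp add: basis_support_def)

lemma GD_homogeneous_iff_basis:
  "Y \<in> GD_homogeneous \<longleftrightarrow> (\<forall>j. Y *v p j \<in> vec.span (q ` basis_support j))"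
proof
  assume "Y \<in> GD_homogeneous"
  then have "(\<forall>v\<in>R. Y *v v = 0) \<and> (\<forall>v\<in>(*v) B ` K. Y *v v \<in> N) \<and> (\<forall>v. Y *v v \<in> K)"
    using GD_homogeneous_iff by blast
  then show "\<forall>j. Y *v p j \<in> vec.span (q ` basis_support j)"
    by (auto simp: span_basis_support)
next
  assume Y: "\<forall>j. Y *v p j \<in> vec.span (q ` basis_support j)"
  have "R \<subseteq> {v. Y *v v = 0}"
  proof (rule adapted_subset[OF p_adapted(1) vec.subspace_kernel])
    fix j assume "p j \<in> R"
    then show "p j \<in> {v. Y *v v = 0}"
      using spec[OF Y, of j] by (simp add: span_basis_support)
  qed
  moreover have "(*v) B ` K \<subseteq> {v. Y *v v \<in> N}"
  proof (rule adapted_subset[OF p_adapted(3) vec.subspace_linear_preimage[OF subspace_N]])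
    fix j assume "p j \<in> (*v) B ` K"
    moreover have "p j \<notin> R"
      using calculation p_in_R_imp_notin_K image_K_subset by blast
    ultimately show "p j \<in> {v. Y *v v \<in> N}"
      using spec[OF Y, of j] by (simp add: span_basis_support)
  qed
  moreover have "range p \<subseteq> {v. Y *v v \<in> K}"
  proof clarify
    fix j
    show "Y *v p j \<in> K"
      using spec[OF Y, of j] N_subset_K vec.subspace_0[OF subspace_K]
      by (auto simp: span_basis_support split: if_splits)
  qed
  then have "vec.span (range p) \<subseteq> {v. Y *v v \<in> K}"
    by (intro vec.span_minimal vec.subspace_linear_preimage[OF subspace_K])
  ultimately show "Y \<in> GD_homogeneous"
    unfolding GD_homogeneous_iff span_indexed_basis[OF p_basis] by blast
qed

lemma card_basis_support:
  "card {(i, j). i \<in> basis_support j}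
    = vec.dim N * vec.dim ((*v) B ` K) + vec.dim K * vec.dim N"
proof -
  let ?J1 = "{j. p j \<in> (*v) B ` K}" and ?J2 = "{j. p j \<in> K} - {j. p j \<in> (*v) B ` K}"
  have "basis_support j =
      (if j \<in> ?J1 then {i. q i \<in> N} else if j \<in> ?J2 then {i. q i \<in> K} else {})" for j
    using p_in_R_or_K[of j] p_in_R_imp_notin_K[of j] image_K_subset
    by (auto simp: basis_support_def)
  then have eq:
    "{(i, j). i \<in> basis_support j} = {i. q i \<in> N} \<times> ?J1 \<union> {i. q i \<in> K} \<times> ?J2"
    by auto
  have "card ?J1 = vec.dim ((*v) B ` K)"
    by (rule card_adapted[OF p_basis p_adapted(3)])
  moreover have "card ?J2 = vec.dim N"
    using card_adapted[OF p_basis p_adapted(3)] card_adapted[OF p_basis p_adapted(2)]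
      dim_image_K_add_dim_N image_K_subset
    by (subst card_Diff_subset) auto
  ultimately show ?thesis
    unfolding eq using card_adapted[OF q_basis q_adapted(1)] card_adapted[OF q_basis q_adapted(2)]
    by (subst card_Un_disjoint) (auto simp: card_cartesian_product)
qed

lemma bij_betw_supported_matrices_GD:
  assumes "X0 \<in> GD"
  shows "bij_betw (\<lambda>M. X0 + column_matrix q ** M ** matrix_inv (column_matrix p))
     {M. \<forall>i j. i \<notin> basis_support j \<longrightarrow> M $ i $ j = 0} GD"
proof -
  have "{Y. \<forall>j. Y *v p j \<in> vec.span (q ` basis_support j)} = GD_homogeneous"
    using GD_homogeneous_iff_basis by blast
  then have "bij_betw (\<lambda>M. column_matrix q ** M ** matrix_inv (column_matrix p))
      {M. \<forall>i j. i \<notin> basis_support j \<longrightarrow> M $ i $ j = 0} GD_homogeneous"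
    using bij_betw_change_of_basis[OF p_basis q_basis, of basis_support] by simp
  moreover have "bij_betw ((+) X0) GD_homogeneous GD"
  proof (rule bij_betw_byWitness[where f' = "\<lambda>X. X - X0"])
    show "(+) X0 ` GD_homogeneous \<subseteq> GD" "(\<lambda>X. X - X0) ` GD \<subseteq> GD_homogeneous"
      using GD_iff_diff_GD_homogeneous[OF assms] by force+
  qed simp_all
  ultimately have "bij_betw
      ((+) X0 \<circ> (\<lambda>M. column_matrix q ** M ** matrix_inv (column_matrix p)))
      {M. \<forall>i j. i \<notin> basis_support j \<longrightarrow> M $ i $ j = 0} GD"
    by (rule bij_betw_trans)
  then show ?thesis
    by (simp add: comp_def)
qed

end

context fitting
begin

lemma ex_fitting_bases: "\<exists>p q. fitting_bases B r p q"
proof -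
  have "K \<inter> R \<subseteq> {0}"
    using R_Int_K by blast
  then obtain p where
    "indexed_basis p" "adapted_to p ((*v) B ` K)" "adapted_to p K" "adapted_to p R"
    using ex_indexed_basis_adapted[OF subspace_image_K subspace_K subspace_R image_K_subset]
    by blast
  moreover obtain q where "indexed_basis q" "adapted_to q N" "adapted_to q K"
    using ex_indexed_basis_adapted[OF subspace_N subspace_K vec.subspace_single_0 N_subset_K]
    by blast
  ultimately show ?thesis
    by (intro exI) unfold_locales
qed

theorem ex_bij_betw_lists_GD:
  assumes "1 \<le> vec.dim N"
  shows "\<exists>f :: 'a list \<times> 'a list \<times> 'a list \<Rightarrow> 'a^'n^'n. bij_betw f
    (kpow (vec.dim N * vec.dim K) \<times> kpow (vec.dim K - vec.dim N)
      \<times> kpow ((vec.dim N - 1) * (vec.dim K - vec.dim N))) GD"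
proof -
  obtain p q where "fitting_bases B r p q"
    using ex_fitting_bases by blast
  then interpret fitting_bases B r p q .
  obtain X0 where "X0 \<in> GD"
    using ex_GD by blast
  obtain g :: "'a list \<Rightarrow> 'a^'n^'n" where
    g: "bij_betw g (kpow (card {(i, j). i \<in> basis_support j}))
      {M. \<forall>i j. (i, j) \<notin> {(i, j). i \<in> basis_support j} \<longrightarrow> M $ i $ j = 0}"
    using bij_betw_lists_supported_matrices by blast
  obtain m where m: "vec.dim N = Suc m"
    using assms by (cases "vec.dim N") auto
  have "vec.dim N * vec.dim K + (vec.dim K - vec.dim N) + (vec.dim N - 1) * (vec.dim K - vec.dim N)
      = card {(i, j). i \<in> basis_support j}"
    unfolding card_basis_support dim_image_K_add_dim_N[symmetric] m by (simp add: algebra_simps)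
  then have "bij_betw ((\<lambda>M. X0 + column_matrix q ** M ** matrix_inv (column_matrix p)) \<circ> g
      \<circ> (\<lambda>(x, y, z). x @ y @ z)) (kpow (vec.dim N * vec.dim K) \<times> kpow (vec.dim K - vec.dim N)
      \<times> kpow ((vec.dim N - 1) * (vec.dim K - vec.dim N))) GD"
    using bij_betw_append3 g bij_betw_supported_matrices_GD[OF \<open>X0 \<in> GD\<close>]
    by (auto intro!: bij_betw_trans)
  then show ?thesis by blast
qed

end

lemma rank_matpow_eq_dim_range:
  "rank (matpow A i) = vec.dim (range ((*v) (matpow (transpose A) i)))"
  by (simp add: rank_eq_dim_range_transpose transpose_matpow)

lemma fitting_transpose:
  fixes A :: "'a::field^'n^'n"
  assumes "mat_index A = r" and "1 \<le> r"
  shows "fitting (transpose A) r"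
proof
  have "r = (LEAST r. rank (matpow A r) = rank (matpow A (Suc r)))"
    using assms(1) by (simp add: mat_index_def)
  then have "rank (matpow A r) = rank (matpow A (Suc r))"
    using LeastI_ex[OF ex_rank_matpow_eq_Suc[of A]] by simp
  then show "vec.dim (range ((*v) (matpow (transpose A) (Suc r))))
      = vec.dim (range ((*v) (matpow (transpose A) r)))"
    by (simp only: rank_matpow_eq_dim_range)
qed (rule assms(2))

theorem mainTheorem12:
  fixes A :: "'a::field^'n^'n"
  assumes "mat_index A = r" and "r \<ge> 1"
  shows "\<exists>f :: 'a list \<times> 'a list \<times> 'a list \<Rightarrow> 'a^'n^'n. bij_betw f
     (kpow (nu 1 A * nu r A) \<times> kpow (nu r A - nu 1 A)
        \<times> kpow ((nu 1 A - 1) * (nu r A - nu 1 A)))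
     (GD_inverses A)"
proof -
  interpret fitting "transpose A" r
    using assms by (rule fitting_transpose)
  have rank_A: "rank A = vec.dim (range ((*v) (transpose A)))"
    using rank_matpow_eq_dim_range[of A 1] by simp
  have "rank (matpow A 0) \<noteq> rank (matpow A 1)"
    using assms not_less_Least[of 0] by (auto simp: mat_index_def)
  then have "1 \<le> vec.dim N"
    using rank_matpow_eq_dim_range[of A 0] rank_A dim_range_add_dim_kernel[of "transpose A"]
    by (simp add: N_def vec_dim_card card_cart_basis)
  moreover have "nu 1 A = vec.dim N" "nu r A = vec.dim K"
    using rank_A rank_matpow_eq_dim_range[of A r] dim_range_add_dim_kernel[of "transpose A"]
      dim_R_add_dim_K
    by (simp_all add: nu_def N_def R_def)
  ultimately obtain f :: "'a list \<times> 'a list \<times> 'a list \<Rightarrow> 'a^'n^'n" where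
    "bij_betw f (kpow (nu 1 A * nu r A) \<times> kpow (nu r A - nu 1 A)
        \<times> kpow ((nu 1 A - 1) * (nu r A - nu 1 A))) GD"
    using ex_bij_betw_lists_GD by auto
  moreover have "bij_betw transpose GD (GD_inverses A)"
    using bij_betw_transpose_GD assms(1) by (simp add: GD_inverses_def)
  ultimately show ?thesis
    by (meson bij_betw_trans)
qed

end
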